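(* Let $X=\mathrm{puz}(\Gamma_{2,3})$ be the state graph of the cylindrical $5$-puzzle, identified via the encoding $f\mapsto(\sigma_f,x_f,y_f)$ with the Cayley graph $\mathrm{Cay}(G,\{\hat{\mathtt L},\hat{\mathtt R},\hat{\mathtt V}\})$, where $G=S_5\times\mathbb{Z}/2\mathbb{Z}\times\mathbb{Z}/3\mathbb{Z}$. Define the following words of length $12$ over $\{\mathtt L,\mathtt R,\mathtt V\}$: $$s=(\mathtt V,\mathtt L,\mathtt V,\mathtt R,\mathtt V,\mathtt L,\mathtt V,\mathtt R,\mathtt V,\mathtt R,\mathtt V,\mathtt L),\qquad s'=(\mathtt V,\mathtt L,\mathtt V,\mathtt R,\mathtt V,\mathtt L,\mathtt V,\mathtt R,\mathtt V,\mathtt R,\mathtt V,\mathtt R),$$ $$t=(\mathtt L,\mathtt V,\mathtt R,\mathtt V,\mathtt L,\mathtt V,\mathtt R,\mathtt V,\mathtt R,\mathtt V,\mathtt L,\mathtt V),\qquad t'=(\mathtt L,\mathtt V,\mathtt R,\mathtt V,\mathtt L,\mathtt V,\mathtt R,\mathtt V,\mathtt R,\mathtt V,\mathtt R,\mathtt V).$$ Let $v=(v_1,\ldots,v_{719})$ be the word of length $719$ obtained by deleting the last letter from the concatenation $$(ss')^{14}\cdot s\,s\cdot(tt')^{15}.$$ Then $\hat v=(\hat v_1,\ldots,\hat v_{719})$ traces a Hamiltonian path of $X$; that is, the sequence of partial products $h_0=(\mathrm{id},0,0)$, $h_i=\hat v_1\hat v_2\cdots\hat v_i$ for $1\le i\le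 719$, is a Hamiltonian path in $X$. In particular, $\mathrm{puz}(\Gamma_{2,3})$ has a Hamiltonian path.
   Context: Sliding block puzzle. For a finite simple graph $\Gamma$ with $n+1$ vertices, a position is a bijection $f:V(\Gamma)\to\{0,1,\ldots,n\}$; the vertex $f^{-1}(0)$ is called blank. A move transforms $f$ into $g=f\circ(v,w)$, where $v,w$ are adjacent vertices of $\Gamma$, one of which is blank in $f$, and $(v,w)$ is the transposition of $v$ and $w$. The state graph $\mathrm{puz}(\Gamma)$ is the undirected graph whose vertices are the positions, with $f,g$ adjacent iff a move transforms $f$ into $g$. The cylindrical grid $\Gamma_{2,3}$ has vertex set $\mathbb{Z}/2\mathbb{Z}\times\mathbb{Z}/3\mathbb{Z}$, with exactly one edge between $v$ and $w$ iff $v-w\in\{\pm(1,0),\pm(0,1)\}$. The puzzle on $\Gamma_{2,3}$ is the cylindrical $5$-puzzle. Conventions for $S_5$: a permutation $\sigma$ is written in one-line notation $\sigma(1)\sigma(2)\sigma(3)\sigma(4)\sigma(5)$ or in cycle notation, and products are compositions $(\sigma\tau)(i)=\sigma(\tau(i))$. Encoding: a position $f$ with blank at $b=(x_f,y_f)$ is encoded as $(\sigma_f,x_f,y_f)\in G=S_5\times\mathbb{Z}/2\mathbb{Z}\times\mathbb{Z}/3\mathbb{Z}$, where $\sigma_f$ has one-line notation $f((0,1)+b)\,f((0,2)+b)\,f((1,0)+b)\,f((1,1)+b)\,f((1,2)+b)$. Put $\mathtt R=(1,2)(3,4,5)$, $\mathtt L=(1,2)(3,5,4)$, $\mathtt V=(1,4)(2,5)$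 in $S_5$, and $\hat{\mathtt R}=(\mathtt R,0,1)$, $\hat{\mathtt L}=(\mathtt L,0,2)$, $\hat{\mathtt V}=(\mathtt V,1,0)$ in $G$. Moving the blank from $b$ to $b+(0,1)$, $b+(0,2)$, $b+(1,0)$ corresponds to right multiplication by $\hat{\mathtt R}$, $\hat{\mathtt L}$, $\hat{\mathtt V}$ respectively. Thus $\mathrm{puz}(\Gamma_{2,3})$ is identified with $\mathrm{Cay}(G,\{\hat{\mathtt L},\hat{\mathtt R},\hat{\mathtt V}\})$, where $\mathrm{Cay}(H,S)$ has vertex set $H$ and an edge from $h_1$ to $h_2$ iff $h_1\xi=h_2$ for some $\xi\in S$. (Here $\hat{\mathtt R}^{-1}=\hat{\mathtt L}$ and $\hat{\mathtt V}^{-1}=\hat{\mathtt V}$, so the edges may be regarded as undirected.) Powers and juxtaposition of words denote repetition and concatenation. A Hamiltonian path is a path visiting every vertex exactly once. *)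

theory Defs
  imports
    "HOL-Algebra.Elementary_Groups"
    "HOL-Algebra.Sym_Groups"
    "HOL-Library.FuncSet"
    "Graph_Theory.Graph_Theory"
begin

text \<open>
  Finite undirected simple graphs are represented by \<^typ>\<open>'a pair_pre_digraph\<close>, with both orientations
  of every edge among the arcs (locale \<^locale>\<open>pair_graph\<close>).
\<close>

definition hamiltonian_path :: "'a pair_pre_digraph \<Rightarrow> 'a list \<Rightarrow> bool" where
  "hamiltonian_path X p \<longleftrightarrow> vpath p (with_proj X) \<and> set p = pverts X"

definition graph_isomorphism_via ::
    "('a \<Rightarrow> 'b) \<Rightarrow> 'a pair_pre_digraph \<Rightarrow> 'b pair_pre_digraph \<Rightarrow> bool" where
  "graph_isomorphism_via \<phi> X Y \<longleftrightarrow>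
    (let hom = \<lparr> iso_verts = \<phi>, iso_arcs = map_prod \<phi> \<phi>, iso_head = snd, iso_tail = fst \<rparr>
     in pre_digraph.digraph_isomorphism (with_proj X) hom \<and>
        app_iso hom (with_proj X) = with_proj Y)"

text \<open>
  A position is a bijection defined on the vertex set only, hence an extensional function: outside
  the vertex set it takes the fixed value \<^term>\<open>undefined\<close>.
\<close>

definition positions :: "'v pair_pre_digraph \<Rightarrow> ('v \<Rightarrow> nat) set" where
  "positions \<Gamma> = {f \<in> extensional (pverts \<Gamma>). bij_betw f (pverts \<Gamma>) {0..<card (pverts \<Gamma>)}}"

definition blank :: "'v pair_pre_digraph \<Rightarrow> ('v \<Rightarrow> nat) \<Rightarrow> 'v" where
  "blank \<Gamma> f = the_inv_into (pverts \<Gamma>) f 0"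

definition is_move :: "'v pair_pre_digraph \<Rightarrow> ('v \<Rightarrow> nat) \<Rightarrow> ('v \<Rightarrow> nat) \<Rightarrow> bool" where
  "is_move \<Gamma> f g \<longleftrightarrow>
    (\<exists>v w. (v, w) \<in> parcs \<Gamma> \<and> (v = blank \<Gamma> f \<or> w = blank \<Gamma> f) \<and>
           g = f \<circ> Transposition.transpose v w)"

definition puz :: "'v pair_pre_digraph \<Rightarrow> ('v \<Rightarrow> nat) pair_pre_digraph" where
  "puz \<Gamma> = \<lparr> pverts = positions \<Gamma>,
            parcs = {(f, g). f \<in> positions \<Gamma> \<and> g \<in> positions \<Gamma> \<and> is_move \<Gamma> f g} \<rparr>"

lemma puz_pair_graph:
  assumes "pair_graph \<Gamma>"
  shows "pair_graph (puz \<Gamma>)"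
proof -
  interpret pair_graph \<Gamma> by fact
  have blank_in: "blank \<Gamma> f \<in> pverts \<Gamma>" "f (blank \<Gamma> f) = 0"
    if f: "f \<in> positions \<Gamma>" "pverts \<Gamma> \<noteq> {}" for f
  proof -
    have b: "bij_betw f (pverts \<Gamma>) {0..<card (pverts \<Gamma>)}" using f by (auto simp: positions_def)
    have "0 \<in> f ` pverts \<Gamma>"
      using b f(2) pair_finite_verts by (simp add: bij_betw_def card_gt_0_iff)
    with b show "blank \<Gamma> f \<in> pverts \<Gamma>" "f (blank \<Gamma> f) = 0"
      unfolding blank_def bij_betw_def by (auto intro: the_inv_into_into f_the_inv_into_f)
  qed
  have blank_unique: "x = blank \<Gamma> f"
    if "f \<in> positions \<Gamma>" "x \<in> pverts \<Gamma>" "f x = 0" for f x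
  proof -
    have "blank \<Gamma> f \<in> pverts \<Gamma>" "f (blank \<Gamma> f) = 0"
      using blank_in[OF that(1)] that(2) by auto
    moreover have "inj_on f (pverts \<Gamma>)"
      using that(1) by (simp add: positions_def bij_betw_def)
    ultimately show ?thesis using that by (metis inj_onD)
  qed
  have finpos: "finite (positions \<Gamma>)"
  proof (rule finite_subset)
    show "positions \<Gamma> \<subseteq> pverts \<Gamma> \<rightarrow>\<^sub>E {0..<card (pverts \<Gamma>)}"
      by (auto simp: positions_def PiE_def bij_betw_def)
    show "finite (pverts \<Gamma> \<rightarrow>\<^sub>E {0..<card (pverts \<Gamma>)})"
      using pair_finite_verts by (simp add: finite_PiE)
  qed
  have move_sym: "is_move \<Gamma> g f"
    if f: "f \<in> positions \<Gamma>" and g: "g \<in> positions \<Gamma>" and m: "is_move \<Gamma> f g" for f g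
  proof -
    obtain v w where vw: "(v, w) \<in> parcs \<Gamma>" "v = blank \<Gamma> f \<or> w = blank \<Gamma> f"
      "g = f \<circ> Transposition.transpose v w"
      using m by (auto simp: is_move_def)
    have V: "v \<in> pverts \<Gamma>" "w \<in> pverts \<Gamma>" using vw(1) by (auto dest: in_arcsD1 in_arcsD2)
    have ne: "pverts \<Gamma> \<noteq> {}" using V by auto
    have "v = blank \<Gamma> g \<or> w = blank \<Gamma> g"
      using vw(2)
    proof
      assume "v = blank \<Gamma> f"
      then have "g w = 0" using blank_in[OF f ne] vw(3) by simp
      then show ?thesis using blank_unique[OF g] V by auto
    next
      assume "w = blank \<Gamma> f"
      then have "g v = 0" using blank_in[OF f ne] vw(3) by simp
      then show ?thesis using blank_unique[OF g] V by auto
    qed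
    moreover have "f = g \<circ> Transposition.transpose v w"
      by (simp add: vw(3) comp_assoc)
    ultimately show ?thesis using vw(1) unfolding is_move_def by blast
  qed
  have no_loop: "\<not> is_move \<Gamma> f f" if f: "f \<in> positions \<Gamma>" for f
  proof
    assume "is_move \<Gamma> f f"
    then obtain v w where vw: "(v, w) \<in> parcs \<Gamma>" "f = f \<circ> Transposition.transpose v w"
      by (auto simp: is_move_def)
    have "f v = f w" using fun_cong[OF vw(2), of v] by simp
    moreover have "v \<in> pverts \<Gamma>" "w \<in> pverts \<Gamma>" "v \<noteq> w"
      using vw(1) by (auto dest: in_arcsD1 in_arcsD2 pair_no_loops)
    ultimately show False using f by (auto simp: positions_def bij_betw_def dest: inj_onD)
  qed
  show ?thesis
  proof
    show "finite (parcs (puz \<Gamma>))"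
      by (rule finite_subset[of _ "positions \<Gamma> \<times> positions \<Gamma>"]) (auto simp: puz_def finpos)
    show "symmetric (with_proj (puz \<Gamma>))"
      by (auto simp: symmetric_def puz_def sym_def intro: move_sym)
    show "fst e \<noteq> snd e" if "e \<in> parcs (puz \<Gamma>)" for e
      using that no_loop by (auto simp: puz_def)
  qed (auto simp: puz_def finpos)
qed

text \<open>
  In general a digraph; it is symmetric whenever \<^term>\<open>S\<close> is closed under inverses.
\<close>

definition Cay :: "('a, 'm) monoid_scheme \<Rightarrow> 'a set \<Rightarrow> 'a pair_pre_digraph" where
  "Cay H S = \<lparr> pverts = carrier H,
              parcs = {(h\<^sub>1, h\<^sub>2). h\<^sub>1 \<in> carrier H \<and> h\<^sub>2 \<in> carrier H \<and>
                                (\<exists>\<xi>\<in>S. h\<^sub>1 \<otimes>\<^bsub>H\<^esub> \<xi> = h\<^sub>2)} \<rparr>"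

definition partial_products :: "('a, 'm) monoid_scheme \<Rightarrow> 'a list \<Rightarrow> 'a list" where
  "partial_products H xs =
    map (\<lambda>i. foldl (\<lambda>h x. h \<otimes>\<^bsub>H\<^esub> x) \<one>\<^bsub>H\<^esub> (take i xs)) [0..<Suc (length xs)]"

text \<open>The elements of $Z/nZ$ are the integers $0, \dots, n-1$.\<close>

abbreviation Z2xZ3 :: "(int \<times> int) monoid" where
  "Z2xZ3 \<equiv> integer_mod_group 2 \<times>\<times> integer_mod_group 3"

definition cyl_grid :: "(int \<times> int) pair_pre_digraph" where
  "cyl_grid = \<lparr> pverts = carrier Z2xZ3,
               parcs = {(v, w). v \<in> carrier Z2xZ3 \<and> w \<in> carrier Z2xZ3 \<and>
                  v \<otimes>\<^bsub>Z2xZ3\<^esub> inv\<^bsub>Z2xZ3\<^esub> w \<in>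
                    {(1, 0), inv\<^bsub>Z2xZ3\<^esub> (1, 0), (0, 1), inv\<^bsub>Z2xZ3\<^esub> (0, 1)}} \<rparr>"

lemma cyl_grid_pair_graph: "pair_graph cyl_grid"
proof -
  have inverse: "inv\<^bsub>Z2xZ3\<^esub> (x, y) = ((- x) mod 2, (- y) mod 3)"
    if "0 \<le> x" "x < 2" "0 \<le> y" "y < 3" for x y
    using that by (simp add: inv_DirProd carrier_integer_mod_group)
  have fin: "finite (carrier Z2xZ3)"
    by (simp add: carrier_integer_mod_group)
  have cases6: "x = (0, 0) \<or> x = (0, 1) \<or> x = (0, 2) \<or> x = (1, 0) \<or> x = (1, 1) \<or> x = (1, 2)"
    if "x \<in> carrier Z2xZ3" for x
    using that by (cases x) (auto simp: carrier_integer_mod_group)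
  have sym: "(w, v) \<in> parcs cyl_grid" "v \<noteq> w" if "(v, w) \<in> parcs cyl_grid" for v w
  proof -
    have "v \<in> carrier Z2xZ3" "w \<in> carrier Z2xZ3"
      using that by (auto simp: cyl_grid_def)
    then have "(w, v) \<in> parcs cyl_grid \<and> v \<noteq> w"
      using cases6[OF \<open>v \<in> carrier Z2xZ3\<close>] cases6[OF \<open>w \<in> carrier Z2xZ3\<close>] that
      by (elim disjE) (simp_all add: cyl_grid_def carrier_integer_mod_group inverse)
    then show "(w, v) \<in> parcs cyl_grid" "v \<noteq> w" by auto
  qed
  show ?thesis
  proof
    show "finite (parcs cyl_grid)"
      by (rule finite_subset[of _ "carrier Z2xZ3 \<times> carrier Z2xZ3"])
        (use fin in \<open>auto simp: cyl_grid_def\<close>)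
    show "finite (pverts cyl_grid)" using fin by (simp add: cyl_grid_def)
    show "symmetric (with_proj cyl_grid)"
      using sym by (auto simp: symmetric_def sym_def)
    show "fst e \<noteq> snd e" if "e \<in> parcs cyl_grid" for e
      using that sym by (cases e) auto
  qed (auto simp: cyl_grid_def)
qed

definition puzzle_group :: "((nat \<Rightarrow> nat) \<times> int \<times> int) monoid" where
  "puzzle_group = sym_group 5 \<times>\<times> Z2xZ3"

definition one_line :: "nat list \<Rightarrow> nat \<Rightarrow> nat" where
  "one_line xs i = (if i \<in> {1..length xs} then xs ! (i - 1) else i)"

definition encode :: "(int \<times> int \<Rightarrow> nat) \<Rightarrow> (nat \<Rightarrow> nat) \<times> int \<times> int" where
  "encode f =
    (let b = blank cyl_grid f
     in (one_line (map (\<lambda>d. f (d \<otimes>\<^bsub>Z2xZ3\<^esub> b)) [(0, 1), (0, 2), (1, 0), (1, 1), (1, 2)]), b))"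

definition decode :: "(nat \<Rightarrow> nat) \<times> int \<times> int \<Rightarrow> int \<times> int \<Rightarrow> nat" where
  "decode = the_inv_into (positions cyl_grid) encode"

datatype letter = L | R | V

fun letter_perm :: "letter \<Rightarrow> nat \<Rightarrow> nat" where
  "letter_perm R = cycle_of_list [1, 2] \<circ> cycle_of_list [3, 4, 5]"
| "letter_perm L = cycle_of_list [1, 2] \<circ> cycle_of_list [3, 5, 4]"
| "letter_perm V = cycle_of_list [1, 4] \<circ> cycle_of_list [2, 5]"

fun hat :: "letter \<Rightarrow> (nat \<Rightarrow> nat) \<times> int \<times> int" where
  "hat R = (letter_perm R, 0, 1)"
| "hat L = (letter_perm L, 0, 2)"
| "hat V = (letter_perm V, 1, 0)"

definition word_pow :: "'a list \<Rightarrow> nat \<Rightarrow> 'a list" where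
  "word_pow w k = concat (replicate k w)"

definition word_s :: "letter list" where
  "word_s = [V, L, V, R, V, L, V, R, V, R, V, L]"

definition word_s' :: "letter list" where
  "word_s' = [V, L, V, R, V, L, V, R, V, R, V, R]"

definition word_t :: "letter list" where
  "word_t = [L, V, R, V, L, V, R, V, R, V, L, V]"

definition word_t' :: "letter list" where
  "word_t' = [L, V, R, V, L, V, R, V, R, V, R, V]"

definition word_v :: "letter list" where
  "word_v = butlast (word_pow (word_s @ word_s') 14 @ word_s @ word_s @
                     word_pow (word_t @ word_t') 15)"

end

theory Submission
  imports Defs
begin

text \<open>
  The product of $ss'$ has order 15; let \<open>\<rho>\<close> be left translation by it. Each block $ss'$ takes the path from
  its current vertex $h$ to \<open>\<rho> h\<close>, and so does each block $tt'$ in the second half. As $s$ and $s'$ differ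
  only in the last letter, the path visits exactly the translates by the 15 powers of \<open>\<rho>\<close> of the 48 vertices
  on one block $ss'$ and one block $tt'$. These 48 vertices are told apart by an invariant of \<open>\<rho>\<close>, so the
  path has $15 \cdot 48 = 720 = |G|$ distinct vertices.
\<close>

subsection \<open>Isomorphisms and Hamiltonian paths\<close>

text \<open>Arcs are pairs of vertices, so injectivity on arcs follows from injectivity on vertices.
  The containment assumed of the arcs of \<open>Y\<close> puts both ends of every arc in the image
  of \<open>\<phi>\<close>, which makes the arc map surjective.\<close>

lemma graph_isomorphism_viaI:
  assumes X: "pair_wf_digraph X"
    and bij: "bij_betw \<phi> (pverts X) (pverts Y)"
    and Y: "parcs Y \<subseteq> pverts Y \<times> pverts Y"
    and arcs: "\<And>u v. u \<in> pverts X \<Longrightarrow> v \<in> pverts X \<Longrightarrow> (u, v) \<in> parcs X \<longleftrightarrow> (\<phi> u, \<phi> v) \<in> parcs Y"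
  shows "graph_isomorphism_via \<phi> X Y"
proof -
  interpret pair_wf_digraph X by fact
  have inj: "inj_on \<phi> (pverts X)" and surj: "\<phi> ` pverts X = pverts Y"
    using bij by (auto simp: bij_betw_def)
  have sub: "parcs X \<subseteq> pverts X \<times> pverts X"
    by (auto dest: in_arcsD1 in_arcsD2)
  have "inj_on (map_prod \<phi> \<phi>) (parcs X)"
    by (rule inj_on_subset[OF map_prod_inj_on[OF inj inj] sub])
  moreover have "map_prod \<phi> \<phi> ` parcs X = parcs Y"
  proof
    show "map_prod \<phi> \<phi> ` parcs X \<subseteq> parcs Y"
      using sub arcs by auto
    show "parcs Y \<subseteq> map_prod \<phi> \<phi> ` parcs X"
    proof
      fix e assume e: "e \<in> parcs Y"
      then obtain u v where "u \<in> pverts X" "v \<in> pverts X" "e = (\<phi> u, \<phi> v)"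
        using Y surj by (cases e) blast
      with e show "e \<in> map_prod \<phi> \<phi> ` parcs X"
        using arcs by (auto intro!: rev_image_eqI[of "(u, v)"])
    qed
  qed
  ultimately show ?thesis
    using inj surj X[folded wf_digraph_wp_iff]
    by (simp add: graph_isomorphism_via_def pre_digraph.digraph_isomorphism_def
        app_iso_def with_proj_def[of Y])
qed

lemma vwalk_arcs_map: "vwalk_arcs (map f p) = map (map_prod f f) (vwalk_arcs p)"
  by (induction p rule: vwalk_arcs.induct) auto

text \<open>Every arc of \<open>Y\<close> is the image of an arc of \<open>X\<close>, so the inverse
  vertex map sends walks back to walks.\<close>

lemma hamiltonian_path_pullback:
  assumes iso: "graph_isomorphism_via \<phi> X Y" and ham: "hamiltonian_path Y p"
  shows "hamiltonian_path X (map (the_inv_into (pverts X) \<phi>) p)"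
proof -
  let ?\<psi> = "the_inv_into (pverts X) \<phi>"
  have X: "pair_wf_digraph X" and inj: "inj_on \<phi> (pverts X)"
    and app: "app_iso \<lparr> iso_verts = \<phi>, iso_arcs = map_prod \<phi> \<phi>, iso_head = snd, iso_tail = fst \<rparr>
        (with_proj X) = with_proj Y"
    using iso by (auto simp: graph_isomorphism_via_def pre_digraph.digraph_isomorphism_def
        wf_digraph_wp_iff)
  interpret pair_wf_digraph X by fact
  have vY: "\<phi> ` pverts X = pverts Y" and aY: "map_prod \<phi> \<phi> ` parcs X = parcs Y"
    using app by (auto simp: app_iso_def with_proj_def)
  have bij: "bij_betw ?\<psi> (pverts Y) (pverts X)"
    using inj vY by (intro bij_betw_the_inv_into) (simp add: bij_betw_def)
  have p: "set p = pverts Y" "distinct p" "p \<noteq> []" "set (vwalk_arcs p) \<subseteq> parcs Y"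
    using ham by (auto simp: hamiltonian_path_def vpath_def vwalk_def)
  have "map_prod ?\<psi> ?\<psi> e \<in> parcs X" if e: "e \<in> parcs Y" for e
  proof -
    obtain u v where uv: "(u, v) \<in> parcs X" "e = (\<phi> u, \<phi> v)"
      using e unfolding aY[symmetric] by auto
    moreover from uv(1) have "u \<in> pverts X" "v \<in> pverts X"
      by (auto dest: in_arcsD1 in_arcsD2)
    ultimately show ?thesis
      using the_inv_into_f_f[OF inj] by simp
  qed
  then have "set (vwalk_arcs (map ?\<psi> p)) \<subseteq> parcs X"
    using p(4) by (auto simp: vwalk_arcs_map)
  then show ?thesis
    using p bij
    by (auto simp: hamiltonian_path_def vpath_def vwalk_def distinct_map bij_betw_def)
qed

text \<open>A repetition-free walk with as many vertices as the graph misses none.\<close>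

lemma hamiltonian_path_if_card:
  assumes "set p \<subseteq> pverts X" "set (vwalk_arcs p) \<subseteq> parcs X" "distinct p"
    and "finite (pverts X)" "card (pverts X) = length p" "p \<noteq> []"
  shows "hamiltonian_path X p"
  using assms card_subset_eq[OF assms(4,1)] distinct_card[OF assms(3)]
  by (auto simp: hamiltonian_path_def vpath_def vwalk_def)


subsection \<open>Walks given by partial products\<close>

text \<open>Recursive form of the partial products. The action \<open>f\<close> is left abstract so
  that the same walk can be run in the group and on an executable model of it.\<close>

fun orbit_list :: "('b \<Rightarrow> 'a \<Rightarrow> 'a) \<Rightarrow> 'a \<Rightarrow> 'b list \<Rightarrow> 'a list" where
  "orbit_list f a [] = [a]"
| "orbit_list f a (x # xs) = a # orbit_list f (f x a) xs"

lemma length_orbit_list [simp]: "length (orbit_list f a xs) = Suc (length xs)"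
  by (induction xs arbitrary: a) auto

lemma orbit_list_conv_foldl:
  "map (\<lambda>i. foldl (\<lambda>h x. f x h) a (take i xs)) [0..<Suc (length xs)] = orbit_list f a xs"
proof (induction xs arbitrary: a)
  case (Cons x xs)
  have "[0..<Suc (length (x # xs))] = 0 # map Suc [0..<Suc (length xs)]"
    by (simp add: map_Suc_upt upt_conv_Cons del: upt_Suc)
  then show ?case
    using Cons.IH[of "f x a"] by (simp only: map_map list.map o_def take_Suc_Cons take_0 foldl.simps orbit_list.simps)
qed simp

lemma length_partial_products: "length (partial_products H xs) = Suc (length xs)"
  by (simp add: partial_products_def)

lemma partial_products_conv_orbit_list:
  "partial_products H (map g ws) = orbit_list (\<lambda>w h. h \<otimes>\<^bsub>H\<^esub> g w) \<one>\<^bsub>H\<^esub> ws"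
proof -
  have "orbit_list (\<lambda>x h. h \<otimes>\<^bsub>H\<^esub> x) a (map g ws) = orbit_list (\<lambda>w h. h \<otimes>\<^bsub>H\<^esub> g w) a ws" for a
    by (induction ws arbitrary: a) auto
  then show ?thesis
    by (simp only: partial_products_def orbit_list_conv_foldl)
qed

text \<open>\<open>\<iota>\<close> intertwines the two actions on the set cut out by
  \<open>P\<close>, hence carries one walk to the other.\<close>

lemma orbit_list_map:
  assumes "P a" "\<And>x a. P a \<Longrightarrow> P (f x a) \<and> \<iota> (f x a) = g x (\<iota> a)"
  shows "orbit_list g (\<iota> a) xs = map \<iota> (orbit_list f a xs)" "\<forall>b \<in> set (orbit_list f a xs). P b"
proof -
  have "orbit_list g (\<iota> a) xs = map \<iota> (orbit_list f a xs) \<and> (\<forall>b \<in> set (orbit_list f a xs). P b)"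
    using assms(1)
  proof (induction xs arbitrary: a)
    case (Cons x xs)
    show ?case
      using assms(2)[OF Cons.prems, of x] Cons.IH[of "f x a"] Cons.prems by simp
  qed simp
  then show "orbit_list g (\<iota> a) xs = map \<iota> (orbit_list f a xs)" "\<forall>b \<in> set (orbit_list f a xs). P b"
    by blast+
qed

lemma orbit_list_Cons: "\<exists>zs. orbit_list f a xs = a # zs"
  by (cases xs) auto

lemma vwalk_arcs_orbit_list:
  assumes "P a" "\<And>x a. P a \<Longrightarrow> P (f x a) \<and> (a, f x a) \<in> E"
  shows "set (vwalk_arcs (orbit_list f a xs)) \<subseteq> E"
  using assms(1)
proof (induction xs arbitrary: a)
  case (Cons x xs)
  then show ?case
    using orbit_list_Cons[of f "f x a" xs] assms(2)[OF Cons.prems, of x] Cons.IH[of "f x a"] by force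
qed simp


subsection \<open>The group $S_5 \times Z/2Z \times Z/3Z$\<close>

lemma one_line_permutes:
  assumes "distinct xs" "set xs = {1..length xs}"
  shows "one_line xs permutes {1..length xs}"
proof (rule bij_imp_permutes)
  have "bij_betw (\<lambda>i. i - 1) {1..length xs} {..<length xs}"
    by (rule bij_betw_byWitness[where f' = Suc]) auto
  moreover have "bij_betw ((!) xs) {..<length xs} {1..length xs}"
    using assms by (intro bij_betw_nth) auto
  ultimately have "bij_betw ((!) xs \<circ> (\<lambda>i. i - 1)) {1..length xs} {1..length xs}"
    by (rule bij_betw_trans)
  then show "bij_betw (one_line xs) {1..length xs} {1..length xs}"
    by (rule bij_betw_cong[THEN iffD1, rotated]) (simp add: one_line_def)
qed (auto simp: one_line_def)

lemma one_line_inject: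
  assumes "length xs = length ys" "one_line xs = one_line ys"
  shows "xs = ys"
proof (rule nth_equalityI)
  fix i assume "i < length xs"
  then show "xs ! i = ys ! i"
    using fun_cong[OF assms(2), of "Suc i"] assms(1) by (simp add: one_line_def)
qed (fact assms(1))

text \<open>Right multiplication permutes the places of a one-line list, so products with generators
  become list rearrangements.\<close>

lemma one_line_comp_letter_perm:
  "one_line [a, b, c, d, e] \<circ> letter_perm R = one_line [b, a, d, e, c]"
  "one_line [a, b, c, d, e] \<circ> letter_perm L = one_line [b, a, e, c, d]"
  "one_line [a, b, c, d, e] \<circ> letter_perm V = one_line [d, e, c, a, b]"
proof -
  \<comment> \<open>Beyond the five points both sides are the identity, so five evaluations and one
    generic case suffice.\<close>
  have eqI: "\<sigma> = \<tau>"
    if "\<forall>i \<in> {1, 2, 3, 4, 5}. \<sigma> i = \<tau> i" "\<forall>i. i \<notin> {1, 2, 3, 4, 5} \<longrightarrow> \<sigma> i = \<tau> i" for \<sigma> \<tau> :: "nat \<Rightarrow> nat"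
    using that by blast
  show "one_line [a, b, c, d, e] \<circ> letter_perm R = one_line [b, a, d, e, c]"
    "one_line [a, b, c, d, e] \<circ> letter_perm L = one_line [b, a, e, c, d]"
    "one_line [a, b, c, d, e] \<circ> letter_perm V = one_line [d, e, c, a, b]"
    by (rule eqI; simp add: one_line_def Transposition.transpose_def; fail)+
qed

lemma Z2xZ3_carrier: "carrier Z2xZ3 = {(0, 0), (0, 1), (0, 2), (1, 0), (1, 1), (1, 2)}"
  by (auto simp: carrier_integer_mod_group)

lemma Z2xZ3_card: "card (carrier Z2xZ3) = 6"
  by (simp add: Z2xZ3_carrier del: carrier_DirProd)

lemma Z2xZ3_inv:
  assumes "b \<in> carrier Z2xZ3"
  shows "inv\<^bsub>Z2xZ3\<^esub> b = ((- fst b) mod 2, (- snd b) mod 3)"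
  using assms by (cases b) (simp add: inv_DirProd)

lemma puzzle_group_mult [simp]:
  "(\<sigma>, b) \<otimes>\<^bsub>puzzle_group\<^esub> (\<tau>, c) = (\<sigma> \<circ> \<tau>, b \<otimes>\<^bsub>Z2xZ3\<^esub> c)"
  by (simp add: puzzle_group_def sym_group_def DirProd_def)

lemma hat_eq: "hat l = (letter_perm l, snd (hat l))"
  by (cases l) auto

lemma group_puzzle_group: "group puzzle_group"
  by (simp add: puzzle_group_def DirProd_group sym_group_is_group)

lemma puzzle_group_carrier:
  "carrier puzzle_group = {\<sigma>. \<sigma> permutes {1..5}} \<times> carrier Z2xZ3"
  by (auto simp: puzzle_group_def sym_group_def)

lemma card_puzzle_group: "card (carrier puzzle_group) = 720"
  by (simp add: puzzle_group_carrier Z2xZ3_carrier card_cartesian_product card_permutations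
      fact_numeral del: carrier_DirProd)

lemma finite_puzzle_group: "finite (carrier puzzle_group)"
  using card_puzzle_group by (intro card_ge_0_finite) simp

lemma one_line_id: "one_line [1, 2, 3, 4, 5] = id"
  by (rule ext) (auto simp: one_line_def nth_Cons' atLeastAtMost_iff)

lemma hat_in_carrier: "hat l \<in> carrier puzzle_group"
proof -
  have perm: "one_line xs permutes {1..5}"
    if "xs \<in> {[2, 1, 4, 5, 3], [2, 1, 5, 3, 4], [4, 5, 3, 1, 2]}" for xs
  proof -
    have "length xs = 5" "distinct xs" "set xs = {1..5}" using that by auto
    then show ?thesis using one_line_permutes[of xs] by simp
  qed
  have "letter_perm l = one_line [1, 2, 3, 4, 5] \<circ> letter_perm l"
    by (simp only: one_line_id id_comp)
  then have "letter_perm l permutes {1..5}"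
    by (cases l) (simp_all only: one_line_comp_letter_perm perm insert_iff simp_thms)
  then show ?thesis
    by (cases l) (auto simp: puzzle_group_carrier Z2xZ3_carrier simp del: carrier_DirProd)
qed


subsection \<open>Relabelled states and their cyclic symmetry\<close>

text \<open>The $S_5$-part of the product of $ss'$ is the 5-cycle $(1\,5\,2\,3\,4)$. Relabelling the tiles by
  $0, \dots, 4$ along it turns left multiplication by this product into \<open>shift 1\<close>.\<close>

definition tile :: "int \<Rightarrow> nat" where
  "tile v = [1, 5, 2, 3, 4] ! nat v"

type_synonym state = "int list \<times> int \<times> int"

definition states :: "state set" where
  "states = {ls. length ls = 5 \<and> distinct ls \<and> set ls = {0..4}} \<times> carrier Z2xZ3"

definition group_element :: "state \<Rightarrow> (nat \<Rightarrow> nat) \<times> int \<times> int" where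
  "group_element = apfst (one_line \<circ> map tile)"

fun letter_act :: "letter \<Rightarrow> state \<Rightarrow> state" where
  "letter_act R (ls, x, y) = ([ls!1, ls!0, ls!3, ls!4, ls!2], x, (y + 1) mod 3)"
| "letter_act L (ls, x, y) = ([ls!1, ls!0, ls!4, ls!2, ls!3], x, (y + 2) mod 3)"
| "letter_act V (ls, x, y) = ([ls!3, ls!4, ls!2, ls!0, ls!1], (x + 1) mod 2, y)"

text \<open>Left multiplication by the \<open>k\<close>-th power of the product of $ss'$. The factor
  2 appears because the letters of $ss'$ sum to 2 in Z/3Z; their sum in Z/2Z is 0.\<close>

fun shift :: "int \<Rightarrow> state \<Rightarrow> state" where
  "shift k (ls, x, y) = (map (\<lambda>v. (v + k) mod 5) ls, x, (y + 2 * k) mod 3)"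

text \<open>Subtracting the first entry undoes the shift of the tiles, and the coordinate that
  shifts move is dropped. On \<open>states\<close> this leaves 4! * 2 = 48 values, as many as there
  are orbits of size 15.\<close>

fun shift_invariant :: "state \<Rightarrow> int list \<times> int" where
  "shift_invariant (ls, x, y) = (map (\<lambda>v. (v - hd ls) mod 5) ls, x)"

lemma length_5E:
  assumes "length xs = 5"
  obtains a b c d e where "xs = [a, b, c, d, e]"
  using assms by (auto simp: numeral_eq_Suc length_Suc_conv)

lemma statesE:
  assumes "z \<in> states"
  obtains a b c d e x y where "z = ([a, b, c, d, e], x, y)" "distinct [a, b, c, d, e]"
    "set [a, b, c, d, e] = {0..4}" "(x, y) \<in> carrier Z2xZ3"
  using assms by (cases z) (auto simp: states_def simp del: carrier_DirProd elim!: length_5E)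

lemma inj_on_tile: "inj_on tile {0..4}" and image_tile: "tile ` {0..4} = {1..5}"
proof -
  have eq: "{0..4} = {0, 1, 2, 3, 4::int}" "{1..5} = {1, 2, 3, 4, 5::nat}" by auto
  show "inj_on tile {0..4}" "tile ` {0..4} = {1..5}"
    unfolding eq by (auto simp: tile_def)
qed

lemma group_element_in_carrier:
  assumes "z \<in> states"
  shows "group_element z \<in> carrier puzzle_group"
proof -
  obtain ls b where z: "z = (ls, b)" "length ls = 5" "distinct ls" "set ls = {0..4}" "b \<in> carrier Z2xZ3"
    using assms by (cases z) (auto simp: states_def simp del: carrier_DirProd)
  then have "distinct (map tile ls)" "set (map tile ls) = {1..length (map tile ls)}"
    using inj_on_tile image_tile by (simp_all add: distinct_map)
  from one_line_permutes[OF this] show ?thesis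
    using z by (simp add: group_element_def puzzle_group_carrier del: carrier_DirProd)
qed

lemma inj_on_group_element: "inj_on group_element states"
proof (rule inj_onI)
  fix z z' assume "z \<in> states" "z' \<in> states" and eq: "group_element z = group_element z'"
  then obtain ls b ls' b' where z: "z = (ls, b)" "length ls = 5" "set ls = {0..4}"
    and z': "z' = (ls', b')" "length ls' = 5" "set ls' = {0..4}"
    by (cases z, cases z') (simp add: states_def)
  have "map tile ls = map tile ls'"
    using eq z(2) z'(2) by (intro one_line_inject) (simp_all add: group_element_def z(1) z'(1))
  then have "ls = ls'"
    using map_inj_on[of tile ls ls'] inj_on_tile z(3) z'(3) by simp
  then show "z = z'"
    using eq by (simp add: group_element_def z(1) z'(1))
qed

lemma letter_act_states:
  assumes "z \<in> states"
  shows "letter_act l z \<in> states"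
    and "group_element (letter_act l z) = group_element z \<otimes>\<^bsub>puzzle_group\<^esub> hat l"
proof -
  obtain a b c d e x y where z: "z = ([a, b, c, d, e], x, y)" and d: "distinct [a, b, c, d, e]"
    and s: "set [a, b, c, d, e] = {0..4}" and xy: "(x, y) \<in> carrier Z2xZ3"
    using assms by (rule statesE)
  have "set (fst (letter_act l z)) = set [a, b, c, d, e]" "distinct (fst (letter_act l z))"
    "length (fst (letter_act l z)) = 5"
    using d unfolding z by (cases l; force)+
  moreover have "snd (letter_act l z) \<in> carrier Z2xZ3"
    using xy unfolding z by (cases l) (auto simp: Z2xZ3_carrier simp del: carrier_DirProd)
  ultimately show "letter_act l z \<in> states"
    using s by (simp add: states_def mem_Times_iff del: carrier_DirProd)
  show "group_element (letter_act l z) = group_element z \<otimes>\<^bsub>puzzle_group\<^esub> hat l"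
    using xy unfolding z group_element_def
    by (subst hat_eq, cases l)
       (simp_all only: letter_act.simps apfst_conv o_apply list.map puzzle_group_mult
          one_line_comp_letter_perm hat.simps snd_conv,
        auto simp: Z2xZ3_carrier simp del: carrier_DirProd)
qed

text \<open>Left and right multiplication commute: letters rearrange places, shifts change values,
  and both only add in the coordinates.\<close>

lemma letter_act_shift:
  assumes "z \<in> states"
  shows "letter_act l (shift k z) = shift k (letter_act l z)"
  using assms by (elim statesE) (cases l; simp add: mod_simps algebra_simps)

lemma fold_letter_act_shift:
  "z \<in> states \<Longrightarrow> fold letter_act w (shift k z) = shift k (fold letter_act w z)"
  by (induction w arbitrary: z) (auto simp: letter_act_states letter_act_shift)

lemma shift_shift: "shift j (shift k z) = shift (j + k) z"
  by (cases z) (simp add: mod_simps algebra_simps)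

lemma shift_0: "z \<in> states \<Longrightarrow> shift 0 z = z"
proof (elim statesE)
  fix a b c d e x y
  assume z: "z = ([a, b, c, d, e], x, y)" "set [a, b, c, d, e] = {0..4}" "(x, y) \<in> carrier Z2xZ3"
  have "v mod 5 = v" if "v \<in> set [a, b, c, d, e]" for v
    using that unfolding z(2) by simp
  then show "shift 0 z = z"
    using z(1,3) by (simp add: carrier_integer_mod_group)
qed

lemma shift_invariant_shift: "z \<in> states \<Longrightarrow> shift_invariant (shift k z) = shift_invariant z"
  by (elim statesE) (simp add: mod_simps)

text \<open>The first entry determines the exponent modulo 5. The last coordinate determines it
  modulo 3, as 2 is invertible there. So the 15 shifts act freely.\<close>

lemma shift_eq_imp_eq:
  assumes "z \<in> states" "shift i z = shift j z" "0 \<le> i" "i < 15" "0 \<le> j" "j < 15"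
  shows "i = j"
proof -
  from assms(1,2) obtain a y where "(a + i) mod 5 = (a + j) mod (5::int)" "(y + 2 * i) mod 3 = (y + 2 * j) mod (3::int)"
    by (elim statesE) auto
  then have "5 dvd i - j" "3 dvd 2 * (i - j)"
    by (simp_all add: mod_eq_dvd_iff algebra_simps)
  moreover have "- 15 < i - j" "i - j < 15" using assms(3-) by auto
  moreover have "d = 0" if "5 dvd d" "3 dvd 2 * d" "- 15 < d" "d < 15" for d :: int
    using that by presburger
  ultimately show ?thesis by fastforce
qed

text \<open>The vertex reached after the last letter is left out, so that the lists of consecutive
  words append without a shared end point.\<close>

fun visits :: "letter list \<Rightarrow> state \<Rightarrow> state list" where
  "visits [] z = []"
| "visits (l # w) z = z # visits w (letter_act l z)"

lemma visits_append: "visits (u @ w) z = visits u z @ visits w (fold letter_act u z)"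
  by (induction u arbitrary: z) auto

text \<open>Deleting the last letter of \<open>w\<close> removes just the end point that
  \<open>visits\<close> omits; the deletion in the definition of $v$ is absorbed here.\<close>

lemma orbit_list_butlast: "w \<noteq> [] \<Longrightarrow> orbit_list letter_act z (butlast w) = visits w z"
  by (induction w arbitrary: z) auto

lemma visits_states: "z \<in> states \<Longrightarrow> set (visits w z) \<subseteq> states"
  by (induction w arbitrary: z) (auto simp: letter_act_states)

lemma visits_shift: "z \<in> states \<Longrightarrow> visits w (shift k z) = map (shift k) (visits w z)"
  by (induction w arbitrary: z) (auto simp: letter_act_states letter_act_shift)

lemma word_pow_simps [simp]: "word_pow w 0 = []" "word_pow w (Suc n) = w @ word_pow w n"
  by (simp_all add: word_pow_def)

text \<open>As \<open>w\<close> moves \<open>z\<close> to \<open>shift 1 z\<close>, it moves every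
  translate of \<open>z\<close> one shift further, so each repetition contributes the next translate
  of one block.\<close>

lemma visits_word_pow:
  assumes "z \<in> states" "fold letter_act w z = shift 1 z"
  shows "set (visits (word_pow w n) (shift k z)) = (\<Union>i<n. shift (k + int i) ` set (visits w z))"
    and "fold letter_act (word_pow w n) (shift k z) = shift (k + int n) z"
proof -
  have step: "fold letter_act w (shift k z) = shift (k + 1) z" for k
    using assms by (simp add: fold_letter_act_shift shift_shift)
  show "set (visits (word_pow w n) (shift k z)) = (\<Union>i<n. shift (k + int i) ` set (visits w z))"
  proof (induction n arbitrary: k)
    case (Suc n)
    show ?case
      using Suc[of "k + 1"] assms(1)
      by (simp add: visits_append step visits_shift lessThan_Suc_eq_insert_0 add.assoc)
  qed simp
  show "fold letter_act (word_pow w n) (shift k z) = shift (k + int n) z"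
    by (induction n arbitrary: k) (simp_all add: step add.assoc)
qed


subsection \<open>The word $v$\<close>

text \<open>\<open>tile\<close> turns this list into 1, 2, 3, 4, 5, so this is the identity of the
  group.\<close>

definition start :: state where
  "start = ([0, 2, 3, 4, 1], 0, 0)"

text \<open>The vertex reached from \<open>start\<close> after $(ss')^{14}ss$.\<close>

definition halfway :: state where
  "halfway = ([0, 2, 4, 1, 3], 0, 1)"

definition representatives :: "state list" where
  "representatives = visits (word_s @ word_s') start @ visits (word_t @ word_t') halfway"

lemma start_halfway_states: "start \<in> states" "halfway \<in> states"
  by (auto simp: start_def halfway_def states_def)

lemma block_products:
  "fold letter_act (word_s @ word_s') start = shift 1 start"
  "fold letter_act (word_s @ word_s) (shift 14 start) = halfway"
  "fold letter_act (word_t @ word_t') halfway = shift 1 halfway"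
  by code_simp+

text \<open>The two words differ only in their last letter, whose effect \<open>visits\<close> does
  not record.\<close>

lemma visits_s_s: "visits (word_s @ word_s) start = visits (word_s @ word_s') start"
  by code_simp

text \<open>Evaluating 48 invariants replaces a comparison of all 720 vertices.\<close>

lemma distinct_invariants: "distinct (map shift_invariant representatives)"
  by code_simp

lemma length_representatives: "length representatives = 48"
  by code_simp

lemma representatives_states: "set representatives \<subseteq> states"
  using visits_states start_halfway_states by (simp add: representatives_def)

lemma length_word_v: "length word_v = 719"
  by (simp add: word_v_def word_pow_def word_s_def word_s'_def word_t_def word_t'_def
      length_concat sum_list_replicate)

definition visited :: "state list" where
  "visited = orbit_list letter_act start word_v"

lemma length_visited: "length visited = 720"
  by (simp add: visited_def length_word_v)

lemma set_visited: "set visited = (\<Union>i<15. shift (int i) ` set representatives)"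
proof -
  let ?A = "set (visits (word_s @ word_s') start)" and ?B = "set (visits (word_t @ word_t') halfway)"
  let ?w = "word_pow (word_s @ word_s') 14 @ (word_s @ word_s) @ word_pow (word_t @ word_t') 15"
  note start = start_halfway_states(1) and halfway = start_halfway_states(2)
  \<comment> \<open>With starting exponent 0, \<open>A(2)\<close> yields the end point
    \<open>shift 14 start\<close> of the first 14 blocks.\<close>
  note A = visits_word_pow[OF start block_products(1), of 14 0, unfolded shift_0[OF start] add_0 of_nat_numeral]
    and B = visits_word_pow(1)[OF halfway block_products(3), of 15 0, unfolded shift_0[OF halfway] add_0]
  have "visited = visits ?w start"
    unfolding visited_def word_v_def append_assoc
    by (rule orbit_list_butlast) (simp add: word_s_def)
  also have "\<dots> = visits (word_pow (word_s @ word_s') 14) start @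
      map (shift 14) (visits (word_s @ word_s') start) @ visits (word_pow (word_t @ word_t') 15) halfway"
    by (simp only: visits_append[of "word_pow (word_s @ word_s') 14"] visits_append[of "word_s @ word_s"]
        A(2) visits_shift[OF start, of "word_s @ word_s"] visits_s_s block_products(2))
  finally have visited: "visited = visits (word_pow (word_s @ word_s') 14) start @
      map (shift 14) (visits (word_s @ word_s') start) @ visits (word_pow (word_t @ word_t') 15) halfway" .
  have "set visited = (\<Union>i<14. shift (int i) ` ?A) \<union> shift 14 ` ?A \<union> (\<Union>i<15. shift (int i) ` ?B)"
    unfolding visited by (simp only: set_append set_map A(1) B Un_assoc)
  \<comment> \<open>The word $ss$ has supplied the missing translate of the first block, the one
    with exponent 14.\<close>
  also have "\<dots> = (\<Union>i<15. shift (int i) ` (?A \<union> ?B))"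
    using lessThan_Suc[of 14] by (auto simp: image_Un)
  finally show ?thesis by (simp add: representatives_def)
qed

lemma distinct_visited: "distinct visited"
proof (rule card_distinct)
  have "distinct representatives"
    using distinct_invariants by (simp add: distinct_map)
  then have card: "card (set representatives) = 48"
    by (simp add: distinct_card length_representatives)
  \<comment> \<open>Equal invariants force equal representatives, and then freeness of the shifts
    forces equal exponents.\<close>
  have "inj_on (\<lambda>(i, z). shift (int i) z) ({..<15} \<times> set representatives)"
  proof (rule inj_onI, clarify)
    fix i j :: nat and z z'
    assume ij: "i < 15" "j < 15" and z: "z \<in> set representatives" "z' \<in> set representatives"
      and eq: "shift (int i) z = shift (int j) z'"
    have st: "z \<in> states" "z' \<in> states"
      using z representatives_states by auto
    have "shift_invariant z = shift_invariant z'"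
      using arg_cong[OF eq, of shift_invariant] st by (simp add: shift_invariant_shift)
    then have "z = z'"
      using distinct_invariants z by (auto simp: distinct_map dest: inj_onD)
    moreover from this have "int i = int j"
      using shift_eq_imp_eq[OF st(1), of "int i" "int j"] eq ij by simp
    ultimately show "i = j \<and> z = z'" by simp
  qed
  moreover have "set visited = (\<lambda>(i, z). shift (int i) z) ` ({..<15} \<times> set representatives)"
    unfolding set_visited by (force simp del: shift.simps)
  ultimately show "card (set visited) = length visited"
    by (simp only: card_image card_cartesian_product card length_visited) simp
qed

lemma visited_states: "set visited \<subseteq> states"
  and partial_products_word_v:
    "partial_products puzzle_group (map hat word_v) = map group_element visited"
proof -
  have one: "\<one>\<^bsub>puzzle_group\<^esub> = group_element start"
    using one_line_id by (simp add: puzzle_group_def sym_group_def group_element_def start_def tile_def)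
  note * = orbit_list_map[where P = "\<lambda>z. z \<in> states" and f = letter_act and \<iota> = group_element
      and g = "\<lambda>l h. h \<otimes>\<^bsub>puzzle_group\<^esub> hat l" and xs = word_v,
      OF start_halfway_states(1) conjI[OF letter_act_states]]
  show "set visited \<subseteq> states"
    using *(2) unfolding visited_def by blast
  show "partial_products puzzle_group (map hat word_v) = map group_element visited"
    unfolding partial_products_conv_orbit_list one visited_def by (rule *(1))
qed

lemma distinct_partial_products_word_v: "distinct (partial_products puzzle_group (map hat word_v))"
  using distinct_visited inj_on_subset[OF inj_on_group_element visited_states]
  by (simp add: partial_products_word_v distinct_map)

section \<open>The Hamiltonian path in the Cayley graph\<close>

abbreviation puzzle_Cay :: "((nat \<Rightarrow> nat) \<times> int \<times> int) pair_pre_digraph" where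
  "puzzle_Cay \<equiv> Cay puzzle_group {hat L, hat R, hat V}"

lemma puzzle_Cay_arcs:
  "(g, h) \<in> parcs puzzle_Cay \<longleftrightarrow> g \<in> carrier puzzle_group \<and> (\<exists>l. h = g \<otimes>\<^bsub>puzzle_group\<^esub> hat l)"
proof -
  have UNIV_letter: "(UNIV :: letter set) = {L, R, V}"
    using letter.exhaust by auto
  have range: "{hat L, hat R, hat V} = range hat"
    unfolding UNIV_letter image_insert image_empty ..
  have "g \<otimes>\<^bsub>puzzle_group\<^esub> hat l \<in> carrier puzzle_group" if "g \<in> carrier puzzle_group" for l
    using that by (rule monoid.m_closed[OF group.is_monoid[OF group_puzzle_group] _ hat_in_carrier])
  then show ?thesis
    unfolding Cay_def pair_pre_digraph.simps range by blast
qed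

lemma partial_products_walk: "set (vwalk_arcs (partial_products puzzle_group (map hat ws))) \<subseteq> parcs puzzle_Cay"
  unfolding partial_products_conv_orbit_list
proof (rule vwalk_arcs_orbit_list[where P = "\<lambda>g. g \<in> carrier puzzle_group"])
  interpret group puzzle_group by (rule group_puzzle_group)
  show "\<one>\<^bsub>puzzle_group\<^esub> \<in> carrier puzzle_group"
    by (rule one_closed)
  show "g \<otimes>\<^bsub>puzzle_group\<^esub> hat l \<in> carrier puzzle_group \<and>
      (g, g \<otimes>\<^bsub>puzzle_group\<^esub> hat l) \<in> parcs puzzle_Cay" if "g \<in> carrier puzzle_group" for l g
    unfolding puzzle_Cay_arcs using m_closed[OF that hat_in_carrier] that by blast
qed

lemma hamiltonian_path_word_v:
  "hamiltonian_path puzzle_Cay (partial_products puzzle_group (map hat word_v))"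
proof (rule hamiltonian_path_if_card)
  show "set (partial_products puzzle_group (map hat word_v)) \<subseteq> pverts puzzle_Cay"
    unfolding partial_products_word_v set_map Cay_def pair_pre_digraph.simps
    by (intro image_subsetI group_element_in_carrier subsetD[OF visited_states])
  show "card (pverts puzzle_Cay) = length (partial_products puzzle_group (map hat word_v))"
    by (simp add: Cay_def card_puzzle_group length_partial_products length_word_v)
  show "finite (pverts puzzle_Cay)"
    by (simp add: Cay_def finite_puzzle_group)
  show "partial_products puzzle_group (map hat word_v) \<noteq> []"
    using length_partial_products[of puzzle_group "map hat word_v"] by force
qed (rule partial_products_walk distinct_partial_products_word_v)+


subsection \<open>The encoding\<close>

lemma cyl_grid_verts: "pverts cyl_grid = carrier Z2xZ3"
  by (simp add: cyl_grid_def)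

text \<open>Each vertex has three neighbours, one per letter: since -1 = 1 modulo 2 and -1 = 2
  modulo 3, the four differences reduce to the three offsets.\<close>

lemma cyl_grid_arcs:
  assumes "b \<in> carrier Z2xZ3"
  shows "(b, w) \<in> parcs cyl_grid \<longleftrightarrow> (\<exists>l. w = snd (hat l) \<otimes>\<^bsub>Z2xZ3\<^esub> b)"
proof -
  have ex: "(\<exists>l. P l) \<longleftrightarrow> P L \<or> P R \<or> P V" for P
    by (metis letter.exhaust)
  show ?thesis
  proof (cases "w \<in> carrier Z2xZ3")
    case True
    then show ?thesis
      using assms unfolding ex cyl_grid_def
      by (simp add: Z2xZ3_inv Z2xZ3_carrier del: carrier_DirProd) (elim disjE; simp)
  next
    case False
    then show ?thesis
      using assms unfolding ex
      by (auto simp: cyl_grid_def carrier_integer_mod_group)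
  qed
qed

lemma positions_blank:
  assumes "f \<in> positions cyl_grid"
  shows "blank cyl_grid f \<in> carrier Z2xZ3" "f (blank cyl_grid f) = 0"
proof -
  have "bij_betw f (carrier Z2xZ3) {0..<6}"
    using assms by (simp add: positions_def cyl_grid_verts Z2xZ3_card del: carrier_DirProd)
  then have "inj_on f (carrier Z2xZ3)" "0 \<in> f ` carrier Z2xZ3"
    by (auto simp: bij_betw_def)
  then show "blank cyl_grid f \<in> carrier Z2xZ3" "f (blank cyl_grid f) = 0"
    unfolding blank_def cyl_grid_verts
    by (auto intro: the_inv_into_into f_the_inv_into_f simp del: carrier_DirProd)
qed

lemma blank_eqI:
  assumes "f \<in> positions cyl_grid" "b \<in> carrier Z2xZ3" "f b = 0"
  shows "blank cyl_grid f = b"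
proof (rule inj_onD)
  show "inj_on f (carrier Z2xZ3)"
    using assms(1) unfolding positions_def bij_betw_def cyl_grid_verts by blast
qed (use assms positions_blank[OF assms(1)] in \<open>simp_all del: carrier_DirProd\<close>)

text \<open>For a vertex \<open>b\<close> these are all five other vertices, adjacent or not, in the
  order in which \<open>encode\<close> reads the tiles.\<close>

definition neighbourhood :: "int \<times> int \<Rightarrow> (int \<times> int) list" where
  "neighbourhood b = map (\<lambda>d. d \<otimes>\<^bsub>Z2xZ3\<^esub> b) [(0, 1), (0, 2), (1, 0), (1, 1), (1, 2)]"

lemma encode_eq: "encode f = (one_line (map f (neighbourhood (blank cyl_grid f))), blank cyl_grid f)"
  by (simp add: encode_def neighbourhood_def Let_def)

lemma length_neighbourhood: "length (neighbourhood b) = 5"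
  by (simp add: neighbourhood_def)

lemma neighbourhood:
  assumes "b \<in> carrier Z2xZ3"
  shows "distinct (neighbourhood b)" "insert b (set (neighbourhood b)) = carrier Z2xZ3"
    "b \<notin> set (neighbourhood b)"
proof -
  have "distinct (neighbourhood b) \<and> insert b (set (neighbourhood b)) = carrier Z2xZ3 \<and>
      b \<notin> set (neighbourhood b)"
    using assms unfolding Z2xZ3_carrier insert_iff empty_iff simp_thms
    by (elim disjE) (simp_all add: neighbourhood_def insert_commute)
  then show "distinct (neighbourhood b)" "insert b (set (neighbourhood b)) = carrier Z2xZ3"
    "b \<notin> set (neighbourhood b)"
    by blast+
qed

text \<open>This is why a move is a right multiplication: re-reading the tiles around the new blank
  permutes the list in a way that depends only on the letter, for every blank \<open>b\<close> and
  every labelling \<open>f\<close>. It is checked for all three letters and six vertices.\<close>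

lemma neighbourhood_transpose:
  assumes "b \<in> carrier Z2xZ3"
  defines "w \<equiv> \<lambda>l. snd (hat l) \<otimes>\<^bsub>Z2xZ3\<^esub> b"
  shows "one_line (map (f \<circ> Transposition.transpose b (w l)) (neighbourhood (w l))) =
    one_line (map f (neighbourhood b)) \<circ> letter_perm l"
  using assms(1) unfolding w_def neighbourhood_def Z2xZ3_carrier insert_iff empty_iff simp_thms
  by (cases l; simp only: list.map one_line_comp_letter_perm hat.simps snd_conv)
     (elim disjE; simp add: Transposition.transpose_def)+

lemma encode_in_carrier:
  assumes f: "f \<in> positions cyl_grid"
  shows "encode f \<in> carrier puzzle_group"
proof -
  let ?b = "blank cyl_grid f"
  note b = positions_blank[OF f] and n = neighbourhood[OF positions_blank(1)[OF f]]
  have bij: "bij_betw f (carrier Z2xZ3) {0..<6}"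
    using f by (simp add: positions_def cyl_grid_verts Z2xZ3_card del: carrier_DirProd)
  have "set (neighbourhood ?b) = carrier Z2xZ3 - {?b}"
    using n by blast
  \<comment> \<open>Removing the blank and its label 0 leaves a bijection onto the labels 1 to
    5.\<close>
  then have "bij_betw f (set (neighbourhood ?b)) ({0..<6} - {0})"
    using bij_betw_DiffI[OF bij, of "{?b}" "{0}"] b by (simp del: carrier_DirProd)
  moreover have "{0..<6} - {0} = {1..5::nat}" by auto
  ultimately have "distinct (map f (neighbourhood ?b))"
    "set (map f (neighbourhood ?b)) = {1..length (map f (neighbourhood ?b))}"
    using n by (simp_all add: distinct_map bij_betw_def length_neighbourhood)
  from one_line_permutes[OF this] show ?thesis
    using b(1) by (simp add: encode_eq puzzle_group_carrier length_neighbourhood del: carrier_DirProd)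
qed

lemma inj_on_encode: "inj_on encode (positions cyl_grid)"
proof (rule inj_onI)
  fix f g assume f: "f \<in> positions cyl_grid" and g: "g \<in> positions cyl_grid" and eq: "encode f = encode g"
  let ?b = "blank cyl_grid f"
  have b: "blank cyl_grid g = ?b" using eq by (simp add: encode_eq)
  have "map f (neighbourhood ?b) = map g (neighbourhood ?b)"
    using eq b by (intro one_line_inject) (simp_all add: encode_eq length_neighbourhood)
  moreover have "f ?b = g ?b"
    using positions_blank(2)[OF f] positions_blank(2)[OF g] b by simp
  ultimately have "f v = g v" if "v \<in> carrier Z2xZ3" for v
  proof -
    have "v = ?b \<or> v \<in> set (neighbourhood ?b)"
      using that neighbourhood(2)[OF positions_blank(1)[OF f]] by blast
    with \<open>map f (neighbourhood ?b) = map g (neighbourhood ?b)\<close> \<open>f ?b = g ?b\<close>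
    show ?thesis by auto
  qed
  \<comment> \<open>Agreement on the grid suffices because positions are extensional.\<close>
  then show "f = g"
    using f g by (auto intro!: extensionalityI[of _ "carrier Z2xZ3"]
        simp: positions_def cyl_grid_verts simp del: carrier_DirProd)
qed

section \<open>Moves as right multiplications by generators\<close>

definition slide :: "letter \<Rightarrow> (int \<times> int \<Rightarrow> nat) \<Rightarrow> int \<times> int \<Rightarrow> nat" where
  "slide l f = f \<circ> Transposition.transpose (blank cyl_grid f) (snd (hat l) \<otimes>\<^bsub>Z2xZ3\<^esub> blank cyl_grid f)"

lemma slide:
  assumes f: "f \<in> positions cyl_grid"
  shows "slide l f \<in> positions cyl_grid" "encode (slide l f) = encode f \<otimes>\<^bsub>puzzle_group\<^esub> hat l"
proof -
  let ?b = "blank cyl_grid f" and ?w = "snd (hat l) \<otimes>\<^bsub>Z2xZ3\<^esub> blank cyl_grid f"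
  note b = positions_blank[OF f]
  have w: "?w \<in> carrier Z2xZ3"
    using b(1) by (cases l) (auto simp: Z2xZ3_carrier simp del: carrier_DirProd)
  have "bij_betw (Transposition.transpose ?b ?w) (carrier Z2xZ3) (carrier Z2xZ3)"
    using b(1) w by (intro permutes_imp_bij permutes_swap_id)
  then have "bij_betw (slide l f) (carrier Z2xZ3) {0..<card (carrier Z2xZ3)}"
    using f unfolding slide_def
    by (auto simp: positions_def cyl_grid_verts simp del: carrier_DirProd intro: bij_betw_trans)
  moreover have "slide l f \<in> extensional (carrier Z2xZ3)"
    using f b(1) w unfolding slide_def extensional_def positions_def cyl_grid_verts
    by (auto simp: Transposition.transpose_def simp del: carrier_DirProd)
  ultimately show pos: "slide l f \<in> positions cyl_grid"
    by (simp add: positions_def cyl_grid_verts del: carrier_DirProd)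
  have b': "blank cyl_grid (slide l f) = ?w"
    using w b(2) by (intro blank_eqI pos) (auto simp: slide_def)
  have "one_line (map (slide l f) (neighbourhood ?w)) = one_line (map f (neighbourhood ?b)) \<circ> letter_perm l"
    unfolding slide_def using b(1) by (rule neighbourhood_transpose)
  \<comment> \<open>Grid offsets are added on the left, whereas the Cayley graph multiplies on the
    right.\<close>
  moreover have "?w = ?b \<otimes>\<^bsub>Z2xZ3\<^esub> snd (hat l)"
    by (cases ?b; cases l) (simp_all add: add.commute)
  ultimately show "encode (slide l f) = encode f \<otimes>\<^bsub>puzzle_group\<^esub> hat l"
    by (subst hat_eq) (simp only: encode_eq b' puzzle_group_mult)
qed

text \<open>The blank may be either end of the arc; symmetry of the arcs and of the transposition
  puts it first.\<close>

lemma is_move_iff_slide: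
  assumes f: "f \<in> positions cyl_grid"
  shows "is_move cyl_grid f g \<longleftrightarrow> (\<exists>l. g = slide l f)"
proof -
  interpret pair_graph cyl_grid by (rule cyl_grid_pair_graph)
  have "is_move cyl_grid f g \<longleftrightarrow>
      (\<exists>w. (blank cyl_grid f, w) \<in> parcs cyl_grid \<and> g = f \<circ> Transposition.transpose (blank cyl_grid f) w)"
    unfolding is_move_def using arcs_symmetric
    by (metis Transposition.transpose_commute)
  then show ?thesis
    unfolding cyl_grid_arcs[OF positions_blank(1)[OF f]] slide_def by blast
qed

text \<open>By injectivity of \<open>encode\<close>, a slide leads to \<open>g\<close> exactly when
  the corresponding product is the code of \<open>g\<close>.\<close>

lemma encode_arc_iff:
  assumes f: "f \<in> positions cyl_grid" and g: "g \<in> positions cyl_grid"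
  shows "(f, g) \<in> parcs (puz cyl_grid) \<longleftrightarrow> (encode f, encode g) \<in> parcs puzzle_Cay"
proof -
  have "g = slide l f \<longleftrightarrow> encode g = encode f \<otimes>\<^bsub>puzzle_group\<^esub> hat l" for l
    using inj_on_eq_iff[OF inj_on_encode g slide(1)[OF f]] slide(2)[OF f] by simp
  then show ?thesis
    using f g by (simp add: puz_def is_move_iff_slide[OF f] puzzle_Cay_arcs encode_in_carrier del: hat.simps)
qed

text \<open>Around the blank at (0, 0) the tiles read 1, 2, 3, 4, 5, so the code of this position is
  the identity.\<close>

definition solved :: "int \<times> int \<Rightarrow> nat" where
  "solved = restrict (\<lambda>(x, y). nat (3 * x + y)) (carrier Z2xZ3)"

lemma solved: "solved \<in> positions cyl_grid" "encode solved = \<one>\<^bsub>puzzle_group\<^esub>"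
proof -
  have "{0..<6} = {0, 1, 2, 3, 4, 5::nat}" by auto
  then have "bij_betw solved (carrier Z2xZ3) {0..<6}"
    by (simp add: bij_betw_def solved_def Z2xZ3_carrier del: carrier_DirProd)
  then show *: "solved \<in> positions cyl_grid"
    by (simp add: positions_def cyl_grid_verts Z2xZ3_card del: carrier_DirProd) (simp add: solved_def)
  have "blank cyl_grid solved = (0, 0)"
    by (rule blank_eqI[OF *]) (simp_all add: solved_def Z2xZ3_carrier del: carrier_DirProd)
  then show "encode solved = \<one>\<^bsub>puzzle_group\<^esub>"
    using one_line_id
    by (simp add: encode_eq neighbourhood_def solved_def Z2xZ3_carrier puzzle_group_def sym_group_one
        del: carrier_DirProd)
qed

text \<open>The image of \<^const>\<open>encode\<close> contains the identity and is closed under the generators, so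
  surjectivity follows from the Hamiltonian path in the Cayley graph.\<close>

lemma bij_betw_encode: "bij_betw encode (positions cyl_grid) (carrier puzzle_group)"
proof -
  have "\<forall>h \<in> set (partial_products puzzle_group (map hat ws)). h \<in> encode ` positions cyl_grid" for ws
    unfolding partial_products_conv_orbit_list
  \<comment> \<open>Only closure under the generators is wanted, so both actions coincide and
    \<open>\<iota>\<close> is trivial.\<close>
  proof (rule orbit_list_map(2)[where \<iota> = id and g = "\<lambda>l h. h \<otimes>\<^bsub>puzzle_group\<^esub> hat l"])
    show "\<one>\<^bsub>puzzle_group\<^esub> \<in> encode ` positions cyl_grid"
      using solved by force
    show "h \<otimes>\<^bsub>puzzle_group\<^esub> hat l \<in> encode ` positions cyl_grid \<and>
        id (h \<otimes>\<^bsub>puzzle_group\<^esub> hat l) = id h \<otimes>\<^bsub>puzzle_group\<^esub> hat l"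
      if "h \<in> encode ` positions cyl_grid" for l h
      using that slide by (auto simp flip: slide(2))
  qed
  moreover have "set (partial_products puzzle_group (map hat word_v)) = carrier puzzle_group"
    using hamiltonian_path_word_v by (simp add: hamiltonian_path_def Cay_def)
  ultimately show ?thesis
    using inj_on_encode encode_in_carrier by (fastforce simp: bij_betw_def)
qed

lemma encode_isomorphism: "graph_isomorphism_via encode (puz cyl_grid) puzzle_Cay"
proof (rule graph_isomorphism_viaI)
  interpret pair_graph "puz cyl_grid"
    by (rule puz_pair_graph[OF cyl_grid_pair_graph])
  show "pair_wf_digraph (puz cyl_grid)" ..
  show "bij_betw encode (pverts (puz cyl_grid)) (pverts puzzle_Cay)"
    using bij_betw_encode by (simp add: puz_def Cay_def)
  show "parcs puzzle_Cay \<subseteq> pverts puzzle_Cay \<times> pverts puzzle_Cay"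
    unfolding Cay_def by auto
  show "(f, g) \<in> parcs (puz cyl_grid) \<longleftrightarrow> (encode f, encode g) \<in> parcs puzzle_Cay"
    if "f \<in> pverts (puz cyl_grid)" "g \<in> pverts (puz cyl_grid)" for f g
    using that by (intro encode_arc_iff) (simp_all add: puz_def)
qed

theorem theorem1:
  shows "graph_isomorphism_via encode (puz cyl_grid) (Cay puzzle_group {hat L, hat R, hat V}) \<and>
    length word_v = 719 \<and>
    hamiltonian_path (Cay puzzle_group {hat L, hat R, hat V})
      (partial_products puzzle_group (map hat word_v)) \<and>
    hamiltonian_path (puz cyl_grid)
      (map decode (partial_products puzzle_group (map hat word_v))) \<and>
    (\<exists>p. hamiltonian_path (puz cyl_grid) p)"
proof -
  \<comment> \<open>\<open>decode\<close> inverts \<open>encode\<close> on the vertex set of the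
    state graph, as the pullback requires.\<close>
  have "hamiltonian_path (puz cyl_grid) (map decode (partial_products puzzle_group (map hat word_v)))"
    using hamiltonian_path_pullback[OF encode_isomorphism hamiltonian_path_word_v]
    by (simp add: puz_def decode_def)
  then show ?thesis
    using encode_isomorphism length_word_v hamiltonian_path_word_v by blast
qed

end
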